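(* Let $\mathbb{K}$ be a field of characteristic zero and let $Q$ be a finite quiver. Then the principal subalgebra $\mathbb{K}Q_{\geq 1}$ is $PI$ if and only if the path algebra $\mathbb{K}Q$ is $PI$.
   Context: A quiver $Q=(Q_0,Q_1,s,t)$ consists of a finite non-empty set $Q_0$ of vertices, a finite non-empty set $Q_1$ of arrows, and maps $s,t:Q_1\to Q_0$ (starting and terminal vertex). A path of length $n\ge 1$ is a sequence $p=\alpha_1\cdots\alpha_n$ of arrows with $t(\alpha_i)=s(\alpha_{i+1})$; $s(p)=s(\alpha_1)$, $t(p)=t(\alpha_n)$. For each vertex $v$ there is a trivial path $e_v$ of length $0$ with $s(e_v)=t(e_v)=v$. The path algebra $\mathbb{K}Q$ has as $\mathbb{K}$-basis all paths (including trivial ones); the product of paths $p,q$ is the concatenation $pq$ if $t(p)=s(q)$ and $0$ otherwise. The principal subalgebra $\mathbb{K}Q_{\ge 1}$ is the subalgebra of $\mathbb{K}Q$ spanned by all non-trivial paths (it need not be unital). Let $X=\{x_1,x_2,\dots\}$ be countably many non-commuting variables and $\mathbb{K}\langle X\rangle$ the free associative algebra. A polynomial $f(x_1,\dots,x_n)\in\mathbb{K}\langle X\rangle$ is a polynomial identity for an associative $\mathbb{K}$-algebra $A$ if $f(a_1,\dots,a_n)=0$ for all $a_1,\dots,a_n\in A$; if $A$ is non-unital, only polynomials with zero constant term are considered. $A$ is called $PI$ if it has a non-zero polynomial identity. *)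

theory Defs
  imports "HOL-Library.Poly_Mapping" "Graph_Theory.Arc_Walk"
begin

section \<open>The free associative algebra\<close>

text \<open>
  Words under concatenation form a monoid, written additively here so that the convolution
  product of \<^theory>\<open>HOL-Library.Poly_Mapping\<close> turns the finitely supported functions on words
  into the free associative unital algebra, as a ring.  The empty word \<open>0\<close> indexes the constant
  term, and the free variables are indexed by \<^typ>\<open>nat\<close>.
\<close>

datatype 'x word = Word (letters: "'x list")

instantiation word :: (type) monoid_add
begin

definition zero_word :: "'x word" where
  "zero_word = Word []"

definition plus_word :: "'x word \<Rightarrow> 'x word \<Rightarrow> 'x word" where
  "plus_word u w = Word (letters u @ letters w)"

instance
  by standard (auto simp: zero_word_def plus_word_def)

end

type_synonym 'k free_algebra = "nat word \<Rightarrow>\<^sub>0 'k"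


section \<open>Associative algebras and polynomial identities\<close>

text \<open>
  An associative algebra, not necessarily unital and not necessarily commutative, is a linear
  subspace \<open>A\<close> of an ambient vector space with a bilinear associative product on \<open>A\<close>.
\<close>

locale assoc_algebra = vector_space scale
  for scale :: "'k::field \<Rightarrow> 'a::ab_group_add \<Rightarrow> 'a" (infixr \<open>*s\<close> 75) +
  fixes A :: "'a set"
    and mult :: "'a \<Rightarrow> 'a \<Rightarrow> 'a" (infixl \<open>\<odot>\<close> 70)
  assumes subspace: "module.subspace scale A"
    and mult_closed: "\<lbrakk>x \<in> A; y \<in> A\<rbrakk> \<Longrightarrow> x \<odot> y \<in> A"
    and mult_assoc: "\<lbrakk>x \<in> A; y \<in> A; z \<in> A\<rbrakk> \<Longrightarrow> (x \<odot> y) \<odot> z = x \<odot> (y \<odot> z)"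
    and mult_add_left: "\<lbrakk>x \<in> A; y \<in> A; z \<in> A\<rbrakk> \<Longrightarrow> (x + y) \<odot> z = x \<odot> z + y \<odot> z"
    and mult_add_right: "\<lbrakk>x \<in> A; y \<in> A; z \<in> A\<rbrakk> \<Longrightarrow> x \<odot> (y + z) = x \<odot> y + x \<odot> z"
    and mult_scale_left: "\<lbrakk>x \<in> A; y \<in> A\<rbrakk> \<Longrightarrow> (c *s x) \<odot> y = c *s (x \<odot> y)"
    and mult_scale_right: "\<lbrakk>x \<in> A; y \<in> A\<rbrakk> \<Longrightarrow> x \<odot> (c *s y) = c *s (x \<odot> y)"
begin

definition is_identity_element :: "'a \<Rightarrow> bool" where
  "is_identity_element e \<longleftrightarrow> e \<in> A \<and> (\<forall>x\<in>A. e \<odot> x = x \<and> x \<odot> e = x)"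

definition unital :: bool where
  "unital \<longleftrightarrow> (\<exists>e. is_identity_element e)"

text \<open>
  The empty word evaluates to the identity element.  If there is none, the value is
  unspecified; it then only ever occurs with coefficient \<open>0\<close> in \<open>polynomial_identity\<close>.
\<close>

fun letters_eval :: "(nat \<Rightarrow> 'a) \<Rightarrow> nat list \<Rightarrow> 'a" where
  "letters_eval a [] = (THE e. is_identity_element e)"
| "letters_eval a [i] = a i"
| "letters_eval a (i # j # w) = a i \<odot> letters_eval a (j # w)"

definition poly_eval :: "(nat \<Rightarrow> 'a) \<Rightarrow> 'k free_algebra \<Rightarrow> 'a" where
  "poly_eval a f =
    (\<Sum>w\<in>Poly_Mapping.keys f. Poly_Mapping.lookup f w *s letters_eval a (letters w))"

text \<open>
  Assigning values to all variables at once is harmless: \<open>poly_eval a f\<close> depends only on the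
  values of \<open>a\<close> at the finitely many variables occurring in \<open>f\<close>.
\<close>

definition polynomial_identity :: "'k free_algebra \<Rightarrow> bool" where
  "polynomial_identity f \<longleftrightarrow>
    (\<not> unital \<longrightarrow> Poly_Mapping.lookup f 0 = 0) \<and> (\<forall>a. (\<forall>i. a i \<in> A) \<longrightarrow> poly_eval a f = 0)"

definition is_PI :: bool where
  "is_PI \<longleftrightarrow> (\<exists>f. f \<noteq> 0 \<and> polynomial_identity f)"

end


section \<open>Quivers and path algebras\<close>

locale quiver = fin_digraph Q
  for Q :: "('v, 'e) pre_digraph" (structure) +
  assumes verts_nonempty: "verts Q \<noteq> {}"
    and arcs_nonempty: "arcs Q \<noteq> {}"

text \<open>
  A path is a triple of its starting vertex, its list of arrows and its terminal vertex; the
  trivial path at \<open>v\<close> is \<open>(v, [], v)\<close>.  Vertices and arrows may repeat, so the appropriate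
  notion of \<^theory>\<open>Graph_Theory.Arc_Walk\<close> is \<open>awalk\<close>, not \<open>apath\<close>.
\<close>

type_synonym ('v, 'e) path = "'v \<times> 'e list \<times> 'v"

definition path_source :: "('v, 'e) path \<Rightarrow> 'v" where
  "path_source p = fst p"

definition path_arcs :: "('v, 'e) path \<Rightarrow> 'e list" where
  "path_arcs p = fst (snd p)"

definition path_target :: "('v, 'e) path \<Rightarrow> 'v" where
  "path_target p = snd (snd p)"

definition path_length :: "('v, 'e) path \<Rightarrow> nat" where
  "path_length p = length (path_arcs p)"

definition paths :: "('v, 'e) pre_digraph \<Rightarrow> ('v, 'e) path set" where
  "paths Q = {p. pre_digraph.awalk Q (path_source p) (path_arcs p) (path_target p)}"

definition path_append :: "('v, 'e) path \<Rightarrow> ('v, 'e) path \<Rightarrow> ('v, 'e) path" where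
  "path_append p q = (path_source p, path_arcs p @ path_arcs q, path_target q)"

text \<open>
  The vector space of finite linear combinations of triples; \<open>Poly_Mapping.single p 1\<close> is the
  basis vector of the path \<open>p\<close>.  The product is the bilinear extension of concatenation and is
  unrelated to the convolution product of \<^theory>\<open>HOL-Library.Poly_Mapping\<close>.
\<close>

type_synonym ('v, 'e, 'k) path_comb = "('v, 'e) path \<Rightarrow>\<^sub>0 'k"

definition path_scale :: "'k::field \<Rightarrow> ('v, 'e, 'k) path_comb \<Rightarrow> ('v, 'e, 'k) path_comb" where
  "path_scale c f = Poly_Mapping.map ((*) c) f"

definition path_mult ::
    "('v, 'e, 'k::field) path_comb \<Rightarrow> ('v, 'e, 'k) path_comb \<Rightarrow> ('v, 'e, 'k) path_comb" where
  "path_mult f g =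
    (\<Sum>p\<in>Poly_Mapping.keys f. \<Sum>q\<in>Poly_Mapping.keys g.
      if path_target p = path_source q
      then Poly_Mapping.single (path_append p q) (Poly_Mapping.lookup f p * Poly_Mapping.lookup g q)
      else 0)"

lemma lookup_path_scale [simp]:
  "Poly_Mapping.lookup (path_scale c f) p = c * Poly_Mapping.lookup f p"
  unfolding path_scale_def by (simp add: Poly_Mapping.map.rep_eq when_def)

global_interpretation path_comb: vector_space
  "path_scale :: 'k::field \<Rightarrow> ('v, 'e, 'k) path_comb \<Rightarrow> ('v, 'e, 'k) path_comb"
  by standard (auto intro!: poly_mapping_eqI simp: lookup_add algebra_simps)

definition path_algebra :: "('v, 'e) pre_digraph \<Rightarrow> ('v, 'e, 'k::field) path_comb set" where
  "path_algebra Q = {f. Poly_Mapping.keys f \<subseteq> paths Q}"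

definition principal_subalgebra :: "('v, 'e) pre_digraph \<Rightarrow> ('v, 'e, 'k::field) path_comb set" where
  "principal_subalgebra Q =
    path_comb.span ((\<lambda>p. Poly_Mapping.single p 1) ` {p \<in> paths Q. path_length p \<ge> 1})"


section \<open>The path algebra and its principal subalgebra are associative algebras\<close>

lemma keys_path_scale: "Poly_Mapping.keys (path_scale c f) \<subseteq> Poly_Mapping.keys f"
  by (auto simp: in_keys_iff)

lemma path_comb_decomp:
  fixes f :: "('v, 'e, 'k::field) path_comb"
  shows "f = (\<Sum>p\<in>Poly_Mapping.keys f. path_scale (Poly_Mapping.lookup f p) (Poly_Mapping.single p 1))"
proof (rule poly_mapping_eqI)
  fix k
  have "(\<Sum>p\<in>Poly_Mapping.keys f. Poly_Mapping.lookup f p * (1 when p = k)) =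
      (\<Sum>p\<in>Poly_Mapping.keys f. if k = p then Poly_Mapping.lookup f p else 0)"
    by (rule sum.cong) (auto simp: when_def)
  then show "Poly_Mapping.lookup f k = Poly_Mapping.lookup (\<Sum>p\<in>Poly_Mapping.keys f.
      path_scale (Poly_Mapping.lookup f p) (Poly_Mapping.single p 1)) k"
    by (simp add: lookup_sum lookup_single in_keys_iff)
qed

lemma subspace_keys:
  "path_comb.subspace {f :: ('v, 'e, 'k::field) path_comb. Poly_Mapping.keys f \<subseteq> S}"
proof -
  have "Poly_Mapping.keys (f + g) \<subseteq> S"
    if "Poly_Mapping.keys f \<subseteq> S" "Poly_Mapping.keys g \<subseteq> S" for f g :: "('v, 'e, 'k) path_comb"
    using that Poly_Mapping.keys_add[of f g] by blast
  moreover have "Poly_Mapping.keys (path_scale c f) \<subseteq> S"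
    if "Poly_Mapping.keys f \<subseteq> S" for c and f :: "('v, 'e, 'k) path_comb"
    using that keys_path_scale[of c f] by blast
  ultimately show ?thesis
    by (auto simp: path_comb.subspace_def)
qed

lemma span_single_eq:
  "path_comb.span ((\<lambda>p. Poly_Mapping.single p 1) ` S) =
    {f :: ('v, 'e, 'k::field) path_comb. Poly_Mapping.keys f \<subseteq> S}" (is "?L = ?R")
proof
  show "?L \<subseteq> ?R"
    by (rule path_comb.span_minimal) (auto simp: subspace_keys)
  show "?R \<subseteq> ?L"
  proof
    fix f :: "('v, 'e, 'k) path_comb"
    assume "f \<in> ?R"
    then have "(\<Sum>p\<in>Poly_Mapping.keys f.
        path_scale (Poly_Mapping.lookup f p) (Poly_Mapping.single p 1)) \<in> ?L"
      by (intro path_comb.span_sum path_comb.span_scale path_comb.span_base) auto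
    then show "f \<in> ?L"
      by (subst path_comb_decomp)
  qed
qed

lemma path_algebra_eq_span:
  "path_algebra Q = path_comb.span ((\<lambda>p. Poly_Mapping.single p (1::'k::field)) ` paths Q)"
  by (simp add: path_algebra_def span_single_eq)

lemma principal_subalgebra_altdef:
  "principal_subalgebra Q =
    {f :: ('v, 'e, 'k::field) path_comb. Poly_Mapping.keys f \<subseteq> {p \<in> paths Q. path_length p \<ge> 1}}"
  by (simp only: principal_subalgebra_def span_single_eq)

lemma path_mult_superset:
  assumes "finite X" "Poly_Mapping.keys f \<subseteq> X" "finite Y" "Poly_Mapping.keys g \<subseteq> Y"
  shows "path_mult f g = (\<Sum>p\<in>X. \<Sum>q\<in>Y. if path_target p = path_source q
      then Poly_Mapping.single (path_append p q) (Poly_Mapping.lookup f p * Poly_Mapping.lookup g q)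
      else 0)"
proof -
  have *: "(\<Sum>q\<in>Poly_Mapping.keys g. if path_target p = path_source q
      then Poly_Mapping.single (path_append p q) (Poly_Mapping.lookup f p * Poly_Mapping.lookup g q)
      else 0) = (\<Sum>q\<in>Y. if path_target p = path_source q
      then Poly_Mapping.single (path_append p q) (Poly_Mapping.lookup f p * Poly_Mapping.lookup g q)
      else 0)" for p
    using assms by (intro sum.mono_neutral_left) (auto simp: in_keys_iff)
  show ?thesis
    unfolding path_mult_def * using assms
    by (intro sum.mono_neutral_left) (auto simp: in_keys_iff intro!: sum.neutral)
qed

lemma path_mult_add_left: "path_mult (f + g) h = path_mult f h + path_mult g h"
proof -
  let ?X = "Poly_Mapping.keys f \<union> Poly_Mapping.keys g"
  have "Poly_Mapping.keys (f + g) \<subseteq> ?X"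
    by (rule Poly_Mapping.keys_add)
  then show ?thesis
    by (subst (1 2 3) path_mult_superset[where X = ?X and Y = "Poly_Mapping.keys h"])
      (auto simp: lookup_add single_add algebra_simps simp flip: sum.distrib intro!: sum.cong)
qed

lemma path_mult_add_right: "path_mult f (g + h) = path_mult f g + path_mult f h"
proof -
  let ?Y = "Poly_Mapping.keys g \<union> Poly_Mapping.keys h"
  have "Poly_Mapping.keys (g + h) \<subseteq> ?Y"
    by (rule Poly_Mapping.keys_add)
  then show ?thesis
    by (subst (1 2 3) path_mult_superset[where X = "Poly_Mapping.keys f" and Y = ?Y])
      (auto simp: lookup_add single_add algebra_simps simp flip: sum.distrib intro!: sum.cong)
qed

lemma path_scale_single: "path_scale c (Poly_Mapping.single p d) = Poly_Mapping.single p (c * d)"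
  by (rule poly_mapping_eqI) (simp add: lookup_single when_def)

lemma path_mult_scale_left: "path_mult (path_scale c f) g = path_scale c (path_mult f g)"
  using keys_path_scale[of c f]
  by (subst (1 2) path_mult_superset[where X = "Poly_Mapping.keys f" and Y = "Poly_Mapping.keys g"])
    (auto simp: path_comb.scale_sum_right path_scale_single mult.assoc intro!: sum.cong)

lemma path_mult_scale_right: "path_mult f (path_scale c g) = path_scale c (path_mult f g)"
  using keys_path_scale[of c g]
  by (subst (1 2) path_mult_superset[where X = "Poly_Mapping.keys f" and Y = "Poly_Mapping.keys g"])
    (auto simp: path_comb.scale_sum_right path_scale_single mult.left_commute intro!: sum.cong)

lemma path_mult_zero [simp]: "path_mult 0 f = 0" "path_mult f 0 = 0"
  by (simp_all add: path_mult_def)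

lemma path_mult_sum_left: "path_mult (sum f I) g = (\<Sum>i\<in>I. path_mult (f i) g)"
  by (induction I rule: infinite_finite_induct) (simp_all add: path_mult_add_left)

lemma path_mult_sum_right: "path_mult g (sum f I) = (\<Sum>i\<in>I. path_mult g (f i))"
  by (induction I rule: infinite_finite_induct) (simp_all add: path_mult_add_right)

lemma path_mult_single:
  "path_mult (Poly_Mapping.single p 1) (Poly_Mapping.single q 1) =
    (if path_target p = path_source q then Poly_Mapping.single (path_append p q) 1 else 0)"
  by (simp add: path_mult_def)

lemma path_comb_induct [case_names zero single add]:
  fixes f :: "('v, 'e, 'k::field) path_comb"
  assumes "P 0" and "\<And>p c. P (path_scale c (Poly_Mapping.single p 1))"
    and "\<And>f g. P f \<Longrightarrow> P g \<Longrightarrow> P (f + g)"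
  shows "P f"
proof -
  have "P (\<Sum>p\<in>I. path_scale (Poly_Mapping.lookup f p) (Poly_Mapping.single p 1))" for I
    by (induction I rule: infinite_finite_induct) (simp_all add: assms)
  then show ?thesis
    by (subst path_comb_decomp)
qed

lemma path_mult_assoc: "path_mult (path_mult f g) h = path_mult f (path_mult g h)"
proof (induction f rule: path_comb_induct)
  case (single p c)
  show ?case
  proof (induction g rule: path_comb_induct)
    case (single q d)
    show ?case
    proof (induction h rule: path_comb_induct)
      case (single r e)
      show ?case
        by (simp add: path_mult_scale_left path_mult_scale_right path_mult_single
            path_append_def path_source_def path_target_def path_arcs_def)
    qed (simp_all add: path_mult_add_right)
  qed (simp_all add: path_mult_add_left path_mult_add_right)
qed (simp_all add: path_mult_add_left)

lemma path_append_in_paths: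
  assumes "wf_digraph Q" "p \<in> paths Q" "q \<in> paths Q" "path_target p = path_source q"
  shows "path_append p q \<in> paths Q"
proof -
  have "pre_digraph.awalk Q (path_source p) (path_arcs p @ path_arcs q) (path_target q)"
    using assms by (intro wf_digraph.awalk_appendI[OF assms(1)]) (auto simp: paths_def)
  then show ?thesis
    by (simp add: paths_def path_append_def path_source_def path_target_def path_arcs_def)
qed

lemma keys_path_mult:
  "Poly_Mapping.keys (path_mult f g) \<subseteq> {path_append p q | p q.
    p \<in> Poly_Mapping.keys f \<and> q \<in> Poly_Mapping.keys g \<and> path_target p = path_source q}"
proof -
  have "Poly_Mapping.keys (path_mult f g) \<subseteq> (\<Union>p\<in>Poly_Mapping.keys f. \<Union>q\<in>Poly_Mapping.keys g.
      Poly_Mapping.keys (if path_target p = path_source q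
      then Poly_Mapping.single (path_append p q) (Poly_Mapping.lookup f p * Poly_Mapping.lookup g q)
      else 0))"
    unfolding path_mult_def by (intro order.trans[OF keys_sum] UN_mono order.refl)
  also have "\<dots> \<subseteq> {path_append p q | p q.
    p \<in> Poly_Mapping.keys f \<and> q \<in> Poly_Mapping.keys g \<and> path_target p = path_source q}"
    by (intro UN_least) (auto split: if_splits simp del: split_paired_Ex)
  finally show ?thesis .
qed

lemma keys_path_mult_subset:
  assumes "\<And>p q. \<lbrakk>p \<in> S; q \<in> S; path_target p = path_source q\<rbrakk> \<Longrightarrow> path_append p q \<in> S"
    and "Poly_Mapping.keys f \<subseteq> S" "Poly_Mapping.keys g \<subseteq> S"
  shows "Poly_Mapping.keys (path_mult f g) \<subseteq> S"
proof
  fix r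
  assume "r \<in> Poly_Mapping.keys (path_mult f g)"
  then obtain p q where "r = path_append p q" "p \<in> Poly_Mapping.keys f" "q \<in> Poly_Mapping.keys g"
    "path_target p = path_source q"
    using keys_path_mult[of f g] by blast
  then show "r \<in> S"
    using assms by blast
qed

context quiver
begin

sublocale path_algebra: assoc_algebra
  "path_scale :: 'k::field \<Rightarrow> ('v, 'e, 'k) path_comb \<Rightarrow> ('v, 'e, 'k) path_comb"
  "path_algebra Q" path_mult
proof unfold_locales
  show "path_comb.subspace (path_algebra Q :: ('v, 'e, 'k) path_comb set)"
    by (simp add: path_algebra_def subspace_keys)
  fix f g :: "('v, 'e, 'k) path_comb"
  assume "f \<in> path_algebra Q" "g \<in> path_algebra Q"
  then show "path_mult f g \<in> path_algebra Q"
    using keys_path_mult_subset[of "paths Q" f g] path_append_in_paths[OF wf_digraph]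
    by (simp add: path_algebra_def)
qed (simp_all add: path_mult_assoc path_mult_add_left path_mult_add_right path_mult_scale_left
    path_mult_scale_right)

sublocale principal: assoc_algebra
  "path_scale :: 'k::field \<Rightarrow> ('v, 'e, 'k) path_comb \<Rightarrow> ('v, 'e, 'k) path_comb"
  "principal_subalgebra Q" path_mult
proof unfold_locales
  show "path_comb.subspace (principal_subalgebra Q :: ('v, 'e, 'k) path_comb set)"
    by (simp add: principal_subalgebra_def)
  have "path_length (path_append p q) = path_length p + path_length q" for p q :: "('v, 'e) path"
    by (simp add: path_length_def path_append_def path_arcs_def)
  moreover fix f g :: "('v, 'e, 'k) path_comb"
  assume "f \<in> principal_subalgebra Q" "g \<in> principal_subalgebra Q"
  ultimately show "path_mult f g \<in> principal_subalgebra Q"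
    using keys_path_mult_subset[of "{p \<in> paths Q. path_length p \<ge> 1}" f g]
      path_append_in_paths[OF wf_digraph]
    by (simp add: principal_subalgebra_altdef)
qed (simp_all add: path_mult_assoc path_mult_add_left path_mult_add_right path_mult_scale_left
    path_mult_scale_right)

lemma path_algebra_unital:
  "assoc_algebra.unital (path_algebra Q :: ('v, 'e, 'k::field) path_comb set) path_mult"
proof -
  let ?A = "path_algebra Q :: ('v, 'e, 'k) path_comb set"
  let ?e = "\<Sum>v\<in>verts Q. Poly_Mapping.single (v, [], v) 1 :: ('v, 'e, 'k) path_comb"
  have "?e \<in> ?A"
    unfolding path_algebra_eq_span
    by (intro path_comb.span_sum path_comb.span_base imageI)
      (simp add: paths_def path_source_def path_target_def path_arcs_def awalk_def)
  moreover have "path_mult ?e x = x \<and> path_mult x ?e = x" if "x \<in> ?A" for x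
    using that unfolding path_algebra_eq_span
  proof (induction rule: path_comb.span_induct_alt)
    case (step c y z)
    then obtain p where p: "p \<in> paths Q" and y: "y = Poly_Mapping.single p 1"
      by blast
    have "path_source p \<in> verts Q" "path_target p \<in> verts Q"
      using p by (auto simp: paths_def)
    then have "path_mult ?e y = y \<and> path_mult y ?e = y"
      unfolding y path_mult_sum_left path_mult_sum_right path_mult_single
      by (simp add: path_append_def path_source_def path_target_def path_arcs_def if_distrib
          cong: if_cong)
    with step show ?case
      by (simp add: path_mult_add_left path_mult_add_right path_mult_scale_left
          path_mult_scale_right)
  qed simp
  ultimately show ?thesis
    unfolding path_algebra.unital_def path_algebra.is_identity_element_def by blast
qed

lemma principal_subalgebra_not_unital:
  "\<not> assoc_algebra.unital (principal_subalgebra Q :: ('v, 'e, 'k::field) path_comb set) path_mult"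
proof
  let ?A = "principal_subalgebra Q :: ('v, 'e, 'k) path_comb set"
  assume "assoc_algebra.unital ?A path_mult"
  then obtain e where e: "e \<in> ?A" "\<And>x. x \<in> ?A \<Longrightarrow> path_mult e x = x"
    unfolding principal.unital_def principal.is_identity_element_def by blast
  obtain \<alpha> where "\<alpha> \<in> arcs Q"
    using arcs_nonempty by blast
  define p where "p = (tail Q \<alpha>, [\<alpha>], head Q \<alpha>)"
  have "p \<in> paths Q" "path_length p = 1"
    using \<open>\<alpha> \<in> arcs Q\<close>
    by (simp_all add: p_def paths_def path_source_def path_target_def path_arcs_def awalk_def
        cas.simps path_length_def)
  then have "path_mult e (Poly_Mapping.single p 1) = Poly_Mapping.single p 1"
    by (intro e(2)) (simp add: principal_subalgebra_altdef)
  then obtain q where "q \<in> Poly_Mapping.keys e" "p = path_append q p"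
    using keys_path_mult[of e "Poly_Mapping.single p 1"] by auto
  moreover from this(2) have "path_length q = 0"
    by (simp add: path_length_def path_append_def path_arcs_def p_def)
  ultimately show False
    using e(1) by (auto simp: principal_subalgebra_altdef)
qed

end

end

theory Submission
  imports Defs
begin

text \<open>
  Commutators of elements of \<open>\<K>Q\<close> lie in \<open>\<K>Q\<^sub>\<ge>\<^sub>1\<close>, because the quotient by this ideal is a product
  of copies of \<open>\<K>\<close>.  So if \<open>f(x\<^sub>0, x\<^sub>1, \<dots>)\<close> is an identity of \<open>\<K>Q\<^sub>\<ge>\<^sub>1\<close>, then
  \<open>f([x\<^sub>0, x\<^sub>1], [x\<^sub>2, x\<^sub>3], \<dots>)\<close> is one of \<open>\<K>Q\<close>.  It is non-zero: the words \<open>x\<^sub>2\<^sub>ix\<^sub>2\<^sub>i\<^sub>+\<^sub>1\<close> form a code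
  avoiding all \<open>x\<^sub>2\<^sub>i\<^sub>+\<^sub>1x\<^sub>2\<^sub>i\<close>, so the image of a word \<open>w\<close> under the code occurs in the substituted
  polynomial with the coefficient of \<open>w\<close> in \<open>f\<close>.  Conversely, an identity of the unital algebra
  \<open>\<K>Q\<close> has zero constant term, as one sees by evaluating at \<open>0\<close>.
\<close>

section \<open>Substitution in the free algebra\<close>

lemma letters_zero [simp]: "letters 0 = []"
  by (simp add: zero_word_def)

lemma letters_plus [simp]: "letters (u + w) = letters u @ letters w"
  by (simp add: plus_word_def)

lemma Word_Nil: "Word [] = 0"
  by (simp add: zero_word_def)

lemma poly_mapping_sum_single:
  "(\<Sum>k\<in>Poly_Mapping.keys f. Poly_Mapping.single k (Poly_Mapping.lookup f k)) = f"
proof (rule poly_mapping_eqI)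
  fix k
  have "(\<Sum>l\<in>Poly_Mapping.keys f. (Poly_Mapping.lookup f l when l = k)) =
      (\<Sum>l\<in>Poly_Mapping.keys f. if k = l then Poly_Mapping.lookup f l else 0)"
    by (rule sum.cong) (auto simp: when_def)
  then show "Poly_Mapping.lookup (\<Sum>k\<in>Poly_Mapping.keys f.
      Poly_Mapping.single k (Poly_Mapping.lookup f k)) k = Poly_Mapping.lookup f k"
    by (simp add: lookup_sum lookup_single in_keys_iff)
qed

lemma lookup_single_mult:
  fixes h :: "'a::monoid_add \<Rightarrow>\<^sub>0 'k::semiring_0"
  shows "Poly_Mapping.lookup (Poly_Mapping.single s c * h) t =
    c * Sum_any (\<lambda>q. Poly_Mapping.lookup h q when t = s + q)"
  by (simp add: lookup_mult lookup_single when_mult)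

lemma lookup_single_zero_mult:
  fixes h :: "'a::monoid_add \<Rightarrow>\<^sub>0 'k::semiring_0"
  shows "Poly_Mapping.lookup (Poly_Mapping.single 0 c * h) t = c * Poly_Mapping.lookup h t"
  by (simp add: lookup_single_mult)

text \<open>Prefixes of equal length can be compared letter by letter, so at most one factorization
  through \<open>Word u\<close> survives in the convolution.\<close>

lemma lookup_single_mult_append:
  fixes h :: "'x word \<Rightarrow>\<^sub>0 'k::semiring_0"
  assumes "length u = length v"
  shows "Poly_Mapping.lookup (Poly_Mapping.single (Word u) c * h) (Word (v @ w)) =
    (if u = v then c * Poly_Mapping.lookup h (Word w) else 0)"
proof -
  have "Word (v @ w) = Word u + q \<longleftrightarrow> u = v \<and> Word w = q" for q
    using assms by (cases q) (auto simp: plus_word_def)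
  then show ?thesis
    by (cases "u = v") (simp_all add: lookup_single_mult)
qed

section \<open>Substitution of commutators for variables\<close>

definition subst_word :: "(nat \<Rightarrow> 'k::comm_ring_1 free_algebra) \<Rightarrow> nat list \<Rightarrow> 'k free_algebra" where
  "subst_word h w = prod_list (map h w)"

text \<open>The unital algebra endomorphism sending the i-th variable to \<open>h i\<close>; scalars
  enter as constant polynomials.\<close>

definition free_subst ::
    "(nat \<Rightarrow> 'k::comm_ring_1 free_algebra) \<Rightarrow> 'k free_algebra \<Rightarrow> 'k free_algebra" where
  "free_subst h f = (\<Sum>w\<in>Poly_Mapping.keys f.
    Poly_Mapping.single 0 (Poly_Mapping.lookup f w) * subst_word h (letters w))"

definition var_commutator :: "nat \<Rightarrow> 'k::comm_ring_1 free_algebra" where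
  "var_commutator i = Poly_Mapping.single (Word [2 * i, 2 * i + 1]) 1
    - Poly_Mapping.single (Word [2 * i + 1, 2 * i]) 1"

text \<open>The word obtained from a product of commutators by choosing the first monomial in each
  factor.\<close>

definition double_word :: "nat list \<Rightarrow> nat list" where
  "double_word w = concat (map (\<lambda>i. [2 * i, 2 * i + 1]) w)"

text \<open>Induction strips two letters at a time. A code word begins with an even letter, so only
  the first monomial of each commutator can match.\<close>

lemma lookup_subst_word_var_commutator:
  "Poly_Mapping.lookup (subst_word var_commutator u :: 'k::comm_ring_1 free_algebra)
    (Word (double_word w)) = (if u = w then 1 else 0)"
proof (induction u arbitrary: w)
  case Nil
  show ?case
    by (cases w) (simp_all add: subst_word_def double_word_def lookup_one when_def zero_word_def)
next
  case (Cons i u)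
  show ?case
  proof (cases w)
    case Nil
    \<comment> \<open>All words in such a product have length at least two.\<close>
    have "Poly_Mapping.lookup (Poly_Mapping.single (Word [a, b]) 1 * h) (Word []) = 0"
      for a b and h :: "'k free_algebra"
      by (simp add: lookup_single_mult plus_word_def)
    with Nil show ?thesis
      by (simp add: subst_word_def double_word_def var_commutator_def left_diff_distrib lookup_minus)
  next
    case (Cons j v)
    have "2 * i + 1 \<noteq> 2 * j" by presburger
    then have *: "Poly_Mapping.lookup (var_commutator i * h) (Word ([2 * j, 2 * j + 1] @ z)) =
        (if i = j then Poly_Mapping.lookup h (Word z) else 0)" for z and h :: "'k free_algebra"
      unfolding var_commutator_def left_diff_distrib lookup_minus
      by (subst (1 2) lookup_single_mult_append) auto
    have "subst_word var_commutator (i # u) =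
        var_commutator i * (subst_word var_commutator u :: 'k free_algebra)"
      "double_word w = [2 * j, 2 * j + 1] @ double_word v"
      by (simp_all add: subst_word_def double_word_def Cons)
    then show ?thesis
      by (simp only: * Cons.IH) (simp add: Cons)
  qed
qed

text \<open>Every other monomial of \<open>f\<close> contributes 0 to this coefficient, so nothing
  cancels.\<close>

lemma lookup_free_subst_var_commutator:
  "Poly_Mapping.lookup (free_subst var_commutator f) (Word (double_word (letters w))) =
    Poly_Mapping.lookup f w"
proof -
  have "letters u = letters w \<longleftrightarrow> w = u" for u
    by (metis word.expand)
  then show ?thesis
    by (simp add: free_subst_def lookup_sum lookup_single_zero_mult if_distrib
        lookup_subst_word_var_commutator in_keys_iff cong: if_cong)
qed

lemma free_subst_var_commutator_nonzero:
  assumes "f \<noteq> 0"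
  shows "free_subst var_commutator f \<noteq> 0"
proof
  assume "free_subst var_commutator f = 0"
  then have "Poly_Mapping.lookup f w = 0" for w
    using lookup_free_subst_var_commutator[of f w] by simp
  with assms show False
    by (simp add: poly_mapping_eqI)
qed


section \<open>Evaluation in associative algebras\<close>

context assoc_algebra
begin

section \<open>Bilinearity and values of words\<close>

lemma mult_zero_left: "x \<in> A \<Longrightarrow> 0 \<odot> x = 0"
  using mult_scale_left[of x x 0] by simp

lemma mult_zero_right: "x \<in> A \<Longrightarrow> x \<odot> 0 = 0"
  using mult_scale_right[of x x 0] by simp

lemma mult_sum_left:
  assumes "\<And>i. i \<in> I \<Longrightarrow> g i \<in> A" "y \<in> A"
  shows "(\<Sum>i\<in>I. g i) \<odot> y = (\<Sum>i\<in>I. g i \<odot> y)"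
  using assms
  by (induction I rule: infinite_finite_induct)
    (simp_all add: mult_zero_left mult_add_left subspace_sum[OF subspace])

lemma mult_sum_right:
  assumes "\<And>i. i \<in> I \<Longrightarrow> g i \<in> A" "y \<in> A"
  shows "y \<odot> (\<Sum>i\<in>I. g i) = (\<Sum>i\<in>I. y \<odot> g i)"
  using assms
  by (induction I rule: infinite_finite_induct)
    (simp_all add: mult_zero_right mult_add_right subspace_sum[OF subspace])

text \<open>Uniqueness of the identity element makes the definite description proper.\<close>

lemma is_identity_element_letters_eval_Nil:
  assumes unital
  shows "is_identity_element (letters_eval a [])"
proof -
  obtain e where "is_identity_element e"
    using assms unfolding unital_def by blast
  moreover have "e' = e" if "is_identity_element e'" for e'
    using that \<open>is_identity_element e\<close> unfolding is_identity_element_def by metis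
  ultimately show ?thesis
    by (auto intro: theI)
qed

lemma letters_eval_closed:
  assumes "unital \<or> w \<noteq> []" "\<And>i. a i \<in> A"
  shows "letters_eval a w \<in> A"
  using assms
proof (induction w rule: induct_list012)
  case 1
  then show ?case
    using is_identity_element_letters_eval_Nil[of a] by (simp add: is_identity_element_def)
qed (simp_all add: mult_closed)

text \<open>The defining recursion stops at one letter to avoid the empty word; an identity element
  merges the two cases.\<close>

lemma letters_eval_Cons:
  assumes unital "\<And>i. a i \<in> A"
  shows "letters_eval a (i # w) = a i \<odot> letters_eval a w"
  using assms is_identity_element_letters_eval_Nil[of a]
  by (cases w) (simp_all add: is_identity_element_def)

lemma letters_eval_append:
  assumes unital "\<And>i. a i \<in> A"
  shows "letters_eval a (u @ w) = letters_eval a u \<odot> letters_eval a w"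
proof (induction u)
  case Nil
  show ?case
    using is_identity_element_letters_eval_Nil[OF assms(1), of a] letters_eval_closed[of w a] assms
    by (simp add: is_identity_element_def)
next
  case (Cons i u)
  then show ?case
    using assms by (simp add: letters_eval_Cons mult_assoc letters_eval_closed del: letters_eval.simps)
qed

section \<open>Evaluation as a homomorphism\<close>

lemma poly_eval_superset:
  assumes "finite X" "Poly_Mapping.keys f \<subseteq> X"
  shows "poly_eval a f = (\<Sum>w\<in>X. Poly_Mapping.lookup f w *s letters_eval a (letters w))"
  unfolding poly_eval_def using assms
  by (intro sum.mono_neutral_left) (auto simp: in_keys_iff)

lemma poly_eval_zero [simp]: "poly_eval a 0 = 0"
  by (simp add: poly_eval_def)

lemma poly_eval_single: "poly_eval a (Poly_Mapping.single w c) = c *s letters_eval a (letters w)"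
  by (simp add: poly_eval_def)

lemma poly_eval_add: "poly_eval a (f + g) = poly_eval a f + poly_eval a g"
  by (subst (1 2 3) poly_eval_superset[where X = "Poly_Mapping.keys f \<union> Poly_Mapping.keys g"])
    (use Poly_Mapping.keys_add[of f g] in
      \<open>auto simp: lookup_add scale_left_distrib sum.distrib\<close>)

lemma poly_eval_diff: "poly_eval a (f - g) = poly_eval a f - poly_eval a g"
  using poly_eval_add[of a "f - g" g] by (simp add: algebra_simps)

lemma poly_eval_sum: "poly_eval a (sum g I) = (\<Sum>i\<in>I. poly_eval a (g i))"
  by (induction I rule: infinite_finite_induct) (simp_all add: poly_eval_add)

lemma poly_eval_closed:
  assumes unital "\<And>i. a i \<in> A"
  shows "poly_eval a f \<in> A"
  unfolding poly_eval_def using assms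
  by (intro subspace_sum[OF subspace] subspace_scale[OF subspace] letters_eval_closed) auto

text \<open>By bilinearity it suffices to treat monomials, where concatenation of words becomes the
  product in \<open>A\<close>.\<close>

lemma poly_eval_mult:
  assumes unital and a: "\<And>i. a i \<in> A"
  shows "poly_eval a (f * g) = poly_eval a f \<odot> poly_eval a g"
proof -
  note closed = poly_eval_closed[OF assms]
  have single: "poly_eval a (Poly_Mapping.single u c * Poly_Mapping.single w d) =
      poly_eval a (Poly_Mapping.single u c) \<odot> poly_eval a (Poly_Mapping.single w d)" for u w c d
    using assms by (simp add: Poly_Mapping.mult_single poly_eval_single letters_eval_append
        letters_eval_closed mult_scale_left mult_scale_right subspace_scale[OF subspace])
  \<comment> \<open>The index sets and coefficients are kept arbitrary, so that \<open>f\<close> and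
    \<open>g\<close> are folded back only at the end.\<close>
  have "poly_eval a ((\<Sum>u\<in>U. Poly_Mapping.single u (\<phi> u)) * (\<Sum>w\<in>W. Poly_Mapping.single w (\<psi> w))) =
      poly_eval a (\<Sum>u\<in>U. Poly_Mapping.single u (\<phi> u)) \<odot>
      poly_eval a (\<Sum>w\<in>W. Poly_Mapping.single w (\<psi> w))" for U W \<phi> \<psi>
    unfolding sum_product poly_eval_sum single
    by (subst sum.swap) (simp add: mult_sum_left mult_sum_right closed subspace_sum[OF subspace])
  from this[where U = "Poly_Mapping.keys f" and \<phi> = "Poly_Mapping.lookup f"
      and W = "Poly_Mapping.keys g" and \<psi> = "Poly_Mapping.lookup g"]
  show ?thesis
    by (simp only: poly_mapping_sum_single)
qed

lemma poly_eval_subst_word: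
  assumes unital "\<And>i. a i \<in> A"
  shows "poly_eval a (subst_word h w) = letters_eval (\<lambda>i. poly_eval a (h i)) w"
proof (induction w)
  case Nil
  show ?case
    \<comment> \<open>The unit is the monomial of the empty word, whose value does not depend on the
      assignment.\<close>
    using poly_eval_single[of a 0 1] by (simp add: subst_word_def)
next
  case (Cons i w)
  then show ?case
    using assms by (simp add: subst_word_def poly_eval_mult letters_eval_Cons poly_eval_closed
        del: letters_eval.simps)
qed

lemma poly_eval_free_subst:
  assumes unital and a: "\<And>i. a i \<in> A"
  shows "poly_eval a (free_subst h f) = poly_eval (\<lambda>i. poly_eval a (h i)) f"
proof -
  have "poly_eval a (Poly_Mapping.single 0 c * subst_word h w) =
      c *s letters_eval (\<lambda>i. poly_eval a (h i)) w" for c w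
  proof -
    have "letters_eval (\<lambda>i. poly_eval a (h i)) w \<in> A"
      by (rule letters_eval_closed) (simp_all add: assms poly_eval_closed)
    \<comment> \<open>Hence the constant polynomial with value \<open>c\<close> acts as scaling by
      \<open>c\<close>.\<close>
    moreover have "is_identity_element (letters_eval a [])"
      using assms by (intro is_identity_element_letters_eval_Nil)
    ultimately show ?thesis
      using assms by (simp add: poly_eval_mult poly_eval_single poly_eval_subst_word
          is_identity_element_def mult_scale_left del: letters_eval.simps)
  qed
  then show ?thesis
    by (simp add: free_subst_def poly_eval_sum poly_eval_def[of "\<lambda>i. poly_eval a (h i)"])
qed

lemma poly_eval_var_commutator:
  "poly_eval a (var_commutator i) = a (2 * i) \<odot> a (2 * i + 1) - a (2 * i + 1) \<odot> a (2 * i)"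
  by (simp add: var_commutator_def poly_eval_diff poly_eval_single)

section \<open>Constant terms of identities\<close>

lemma poly_eval_at_zero:
  assumes unital
  shows "poly_eval (\<lambda>_. 0) f = Poly_Mapping.lookup f 0 *s letters_eval (\<lambda>_. 0) []"
proof -
  have "letters_eval (\<lambda>_. 0) w = 0" if "w \<noteq> []" for w
    using that assms subspace_0[OF subspace]
    by (cases w) (simp_all add: letters_eval_Cons letters_eval_closed mult_zero_left
        del: letters_eval.simps(2,3))
  then have "letters_eval (\<lambda>_. 0) (letters w) = 0" if "w \<noteq> 0" for w :: "nat word"
    using that by (cases w) (auto simp: zero_word_def)
  then show ?thesis
    \<comment> \<open>Inserting 0 splits off the constant term even when its coefficient
      vanishes.\<close>
    by (subst poly_eval_superset[where X = "insert 0 (Poly_Mapping.keys f)"])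
      (auto simp: sum.insert_remove intro!: sum.neutral simp del: letters_eval.simps)
qed

text \<open>In the unital case, evaluation at 0 leaves a multiple of the identity element, which is
  non-zero because \<open>A \<noteq> {0}\<close>; in the zero algebra every polynomial is an
  identity.\<close>

lemma polynomial_identity_constant_term:
  assumes "A \<noteq> {0}" "polynomial_identity f"
  shows "Poly_Mapping.lookup f 0 = 0"
proof (cases unital)
  case True
  have e: "is_identity_element (letters_eval (\<lambda>_. 0) [])"
    using True by (rule is_identity_element_letters_eval_Nil)
  have "letters_eval (\<lambda>_. 0) [] \<noteq> 0"
  proof
    assume "letters_eval (\<lambda>_. 0) [] = 0"
    with e have "x = 0" if "x \<in> A" for x
      using that mult_zero_left[OF that] by (simp add: is_identity_element_def)
    with assms(1) subspace_0[OF subspace] show False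
      by blast
  qed
  moreover have "poly_eval (\<lambda>_. 0) f = 0"
    using assms(2) subspace_0[OF subspace] by (simp add: polynomial_identity_def)
  ultimately show ?thesis
    by (simp add: poly_eval_at_zero[OF True] del: letters_eval.simps)
qed (use assms in \<open>simp add: polynomial_identity_def\<close>)

section \<open>Transfer of identities between algebras\<close>

text \<open>
  Without a constant term the unspecified value of the empty word does not matter, so evaluation
  does not depend on the subspace.
\<close>

lemma poly_eval_cong_subspace:
  assumes "assoc_algebra scale B mult" "Poly_Mapping.lookup f 0 = 0"
  shows "assoc_algebra.poly_eval scale B mult a f = poly_eval a f"
proof -
  interpret B: assoc_algebra scale B mult by fact
  have "B.letters_eval a w = letters_eval a w" if "w \<noteq> []" for w
    using that by (induction w rule: induct_list012) simp_all
  moreover have "letters w \<noteq> []" if "w \<in> Poly_Mapping.keys f" for w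
    using that assms(2) by (cases w) (auto simp: in_keys_iff Word_Nil)
  ultimately show ?thesis
    unfolding B.poly_eval_def poly_eval_def by (intro sum.cong) auto
qed

text \<open>\<open>B\<close> may lack an identity element or have a different one, so the constant
  term must vanish before \<open>f\<close> can be reused.\<close>

lemma is_PI_subalgebra:
  assumes "is_PI" "A \<noteq> {0}" "assoc_algebra scale B mult" "B \<subseteq> A"
  shows "assoc_algebra.is_PI scale B mult"
proof -
  interpret B: assoc_algebra scale B mult by fact
  obtain f where f: "f \<noteq> 0" "polynomial_identity f"
    using assms(1) unfolding is_PI_def by blast
  then have "Poly_Mapping.lookup f 0 = 0"
    using assms(2) by (intro polynomial_identity_constant_term)
  then have "B.polynomial_identity f"
    using f(2) assms(4) poly_eval_cong_subspace[OF assms(3)]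
    unfolding B.polynomial_identity_def polynomial_identity_def by (metis subsetD)
  with f(1) show ?thesis
    unfolding B.is_PI_def by blast
qed

text \<open>Commutators of elements of \<open>A\<close> are admissible values for the variables of
  an identity of \<open>B\<close>.\<close>

lemma is_PI_if_commutators_in_PI:
  assumes unital "assoc_algebra scale B mult" "assoc_algebra.is_PI scale B mult" "B \<noteq> {0}"
    and commutator: "\<And>x y. \<lbrakk>x \<in> A; y \<in> A\<rbrakk> \<Longrightarrow> x \<odot> y - y \<odot> x \<in> B"
  shows "is_PI"
proof -
  interpret B: assoc_algebra scale B mult by fact
  obtain f where f: "f \<noteq> 0" "B.polynomial_identity f"
    using assms(3) unfolding B.is_PI_def by blast
  then have f0: "Poly_Mapping.lookup f 0 = 0"
    using assms(4) by (intro B.polynomial_identity_constant_term)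
  have "poly_eval a (free_subst var_commutator f) = 0" if a: "\<And>i. a i \<in> A" for a
  proof -
    \<comment> \<open>By \<open>f0\<close>, evaluating \<open>f\<close> gives the same result in
      \<open>A\<close> and in \<open>B\<close>.\<close>
    have "poly_eval a (free_subst var_commutator f) =
        B.poly_eval (\<lambda>i. poly_eval a (var_commutator i)) f"
      using assms(1) a by (simp add: poly_eval_free_subst poly_eval_cong_subspace[OF assms(2) f0])
    also have "\<dots> = 0"
      using f(2) a commutator by (simp add: B.polynomial_identity_def poly_eval_var_commutator)
    finally show ?thesis .
  qed
  then have "polynomial_identity (free_subst var_commutator f)"
    using assms(1) by (simp add: polynomial_identity_def)
  then show ?thesis
    unfolding is_PI_def using free_subst_var_commutator_nonzero[OF f(1)] by blast
qed

end


section \<open>Path algebras\<close>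

context quiver
begin

lemma principal_subalgebra_subset: "principal_subalgebra Q \<subseteq> path_algebra Q"
  by (auto simp: principal_subalgebra_altdef path_algebra_def)

text \<open>The zero algebra has the identity element 0, whereas
  \<open>principal_subalgebra Q\<close> has none.\<close>

lemma principal_subalgebra_nontrivial:
  "(principal_subalgebra Q :: ('v, 'e, 'k::field) path_comb set) \<noteq> {0}"
proof
  assume "(principal_subalgebra Q :: ('v, 'e, 'k) path_comb set) = {0}"
  then have "principal.is_identity_element (0 :: ('v, 'e, 'k) path_comb)"
    unfolding principal.is_identity_element_def by simp
  then show False
    using principal_subalgebra_not_unital[where 'k = 'k] unfolding principal.unital_def by blast
qed

text \<open>Bilinearity reduces the claim to two paths. Trivial paths commute, and a product with a
  non-trivial factor is 0 or a non-trivial path.\<close>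

lemma commutator_in_principal_subalgebra:
  fixes f g :: "('v, 'e, 'k::field) path_comb"
  assumes "f \<in> path_algebra Q" "g \<in> path_algebra Q"
  shows "path_mult f g - path_mult g f \<in> principal_subalgebra Q"
proof -
  note sub = principal.subspace
  have basis: "path_mult (Poly_Mapping.single p 1) (Poly_Mapping.single q 1)
      - path_mult (Poly_Mapping.single q 1) (Poly_Mapping.single p 1)
      \<in> (principal_subalgebra Q :: ('v, 'e, 'k) path_comb set)"
    if p: "p \<in> paths Q" and q: "q \<in> paths Q" for p q
  proof (cases "path_length p = 0 \<and> path_length q = 0")
    case True
    \<comment> \<open>Two trivial paths at one vertex are equal; at distinct vertices both products
      vanish.\<close>
    then have "path_source p = path_target p" "path_source q = path_target q"
      using p q by (auto simp: paths_def path_length_def awalk_def)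
    with True show ?thesis
      by (auto simp: path_mult_single path_append_def path_length_def path_comb.subspace_0[OF sub])
  next
    case False
    have "path_mult (Poly_Mapping.single r 1) (Poly_Mapping.single s 1)
        \<in> (principal_subalgebra Q :: ('v, 'e, 'k) path_comb set)"
      if "r \<in> paths Q" "s \<in> paths Q" "path_length r \<noteq> 0 \<or> path_length s \<noteq> 0" for r s
    proof (cases "path_target r = path_source s")
      case True
      have "path_length (path_append r s) = path_length r + path_length s"
        by (simp add: path_length_def path_append_def path_arcs_def)
      with that True path_append_in_paths[OF wf_digraph that(1,2) True] show ?thesis
        by (auto simp: path_mult_single principal_subalgebra_altdef)
    qed (simp add: path_mult_single path_comb.subspace_0[OF sub])
    with p q False show ?thesis
      by (intro path_comb.subspace_diff[OF sub]) metis+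
  qed
  \<comment> \<open>Linearity in \<open>g\<close> with a path fixed; linearity in \<open>f\<close>
    completes the argument below.\<close>
  have right: "path_mult (Poly_Mapping.single p 1) g - path_mult g (Poly_Mapping.single p 1)
      \<in> principal_subalgebra Q" if p: "p \<in> paths Q" for p
    using assms(2) unfolding path_algebra_eq_span
  proof (induction rule: path_comb.span_induct_alt)
    case base
    show ?case by (simp add: path_comb.subspace_0[OF sub])
  next
    case (step c y z)
    let ?p = "Poly_Mapping.single p 1 :: ('v, 'e, 'k) path_comb"
    have "path_mult ?p (path_scale c y + z) - path_mult (path_scale c y + z) ?p =
        path_scale c (path_mult ?p y - path_mult y ?p) + (path_mult ?p z - path_mult z ?p)"
      by (simp add: path_mult_add_left path_mult_add_right path_mult_scale_left
          path_mult_scale_right path_comb.scale_right_diff_distrib)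
    with step basis[OF p] show ?case
      by (auto intro!: path_comb.subspace_add[OF sub] path_comb.subspace_scale[OF sub])
  qed
  show ?thesis
    using assms(1) unfolding path_algebra_eq_span
  proof (induction rule: path_comb.span_induct_alt)
    case base
    show ?case by (simp add: path_comb.subspace_0[OF sub])
  next
    case (step c y z)
    have "path_mult (path_scale c y + z) g - path_mult g (path_scale c y + z) =
        path_scale c (path_mult y g - path_mult g y) + (path_mult z g - path_mult g z)"
      by (simp add: path_mult_add_left path_mult_add_right path_mult_scale_left
          path_mult_scale_right path_comb.scale_right_diff_distrib)
    with step right show ?case
      by (auto intro!: path_comb.subspace_add[OF sub] path_comb.subspace_scale[OF sub])
  qed
qed

end

theorem theorem1p1:
  fixes Q :: "('v, 'e) pre_digraph"
  assumes "quiver Q"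
  shows "assoc_algebra.is_PI path_scale
           (principal_subalgebra Q :: ('v, 'e, 'k::field_char_0) path_comb set) path_mult
     \<longleftrightarrow> assoc_algebra.is_PI path_scale
           (path_algebra Q :: ('v, 'e, 'k) path_comb set) path_mult"
proof -
  interpret quiver Q by fact
  have nontrivial: "(path_algebra Q :: ('v, 'e, 'k) path_comb set) \<noteq> {0}"
    using principal_subalgebra_subset[where 'a = 'k] principal_subalgebra_nontrivial[where 'k = 'k]
      path_comb.subspace_0[OF principal.subspace] by blast
  show ?thesis
    \<comment> \<open>The first fact yields the forward direction, the second the converse.\<close>
    using path_algebra.is_PI_if_commutators_in_PI[OF path_algebra_unital
        principal.assoc_algebra_axioms _ principal_subalgebra_nontrivial
        commutator_in_principal_subalgebra]
      path_algebra.is_PI_subalgebra[OF _ nontrivial principal.assoc_algebra_axioms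
        principal_subalgebra_subset]
    by blast
qed

end
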